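(* Let $\Gamma \subseteq \omega^\omega$ be a nonempty subshift of bounded type. If the periodic points of $\sigma$ in $\Gamma$ are dense in $\Gamma$ and $\Gamma$ is perfect, then $\Gamma$ contains an uncountable set that is distributionally scrambled of type 1.
   Context: $\mathbb{N}=\{1,2,3,\dots\}$ and $\omega = \mathbb{N}\cup\{0\}$ with the discrete topology; $X=\omega^\omega$ (infinite sequences $x=x_0x_1x_2\dots$ over $\omega$) carries the product topology, which is compatible with the metric $d(x,y)=\inf_{n\in\omega}\{2^{-n} : x_i=y_i \ \forall i<n\}$. The shift map is $\sigma:X\to X$, $\sigma(x_0x_1x_2\dots)=x_1x_2\dots$. A subshift is a closed subset $\Gamma\subseteq\omega^\omega$ that is invariant under $\sigma$ ($\sigma(\Gamma)\subseteq\Gamma$). A point $x$ is periodic if $\sigma^p(x)=x$ for some $p\ge 1$. $\Gamma$ is perfect if it (is closed and) has no isolated points in the subspace topology. For $i<j$ write $x_{[i,j)}=x_ix_{i+1}\dots x_{j-1}$ (and likewise for finite words). A finite word $w$ over $\omega$ of length $n$ is an allowed word of $\Gamma$ if there are $x\in\Gamma$ and $i\in\omega$ with $w=x_{[i,i+n)}$; $B(\Gamma)$ is the set of all allowed words. A finite word not in $B(\Gamma)$ is a forbidden word. A set $\mathcal{F}(\Gamma)$ of forbidden words is a basis of forbidden words of $\Gamma$ if every forbidden word $w$ has a subword $w_{[i,j)}\in\mathcal{F}(\Gamma)$ with $0\le i<j\le |w|$, where $|w|$ is the length of $w$. A subshift $\Gamma$ is a subshift of bounded type if there exist $K\in\mathbb{N}$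 and a basis of forbidden words $\mathcal{F}(\Gamma)$ of $\Gamma$ such that $|w|<K$ for every $w\in\mathcal{F}(\Gamma)$. Let $\xi(x,y,\epsilon,n)=|\{i : i<n,\ d(\sigma^i(x),\sigma^i(y))<\epsilon\}|$ (cardinality, $i\in\omega$). Points $x,y$ form a distributionally chaotic pair of type 1 (DC1 pair) if $\limsup_{n\to\infty}\frac1n\xi(x,y,\epsilon,n)=1$ for all $\epsilon>0$ and $\liminf_{n\to\infty}\frac1n\xi(x,y,\delta,n)=0$ for some $\delta>0$. A set $D\subseteq\Gamma$ is distributionally scrambled of type 1 if every pair $x\ne y$ in $D$ forms a DC1 pair. *)

theory Defs
  imports "HOL-Analysis.Analysis"
begin

text \<open>Points of \<open>\<omega>\<^sup>\<omega>\<close> have type \<^typ>\<open>nat \<Rightarrow> nat\<close>. Its type-class topology is the product of the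
  discrete topologies, and \<^const>\<open>closed\<close>, \<^const>\<open>closure\<close> and \<open>isolated_in\<close> refer to it.
  Distances are measured by \<open>seq_dist\<close> below, not by the metric \<^const>\<open>dist\<close> that the library
  puts on this type; both induce the product topology.\<close>

definition seq_dist :: "(nat \<Rightarrow> nat) \<Rightarrow> (nat \<Rightarrow> nat) \<Rightarrow> real" where
  "seq_dist x y = Inf {1 / 2 ^ n | n. \<forall>i<n. x i = y i}"

definition shift_map :: "(nat \<Rightarrow> nat) \<Rightarrow> nat \<Rightarrow> nat" where
  "shift_map x = (\<lambda>i. x (Suc i))"

definition subshift :: "(nat \<Rightarrow> nat) set \<Rightarrow> bool" where
  "subshift \<Gamma> \<longleftrightarrow> closed \<Gamma> \<and> shift_map ` \<Gamma> \<subseteq> \<Gamma>"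

definition periodic_point :: "(nat \<Rightarrow> nat) \<Rightarrow> bool" where
  "periodic_point x \<longleftrightarrow> (\<exists>p\<ge>1. (shift_map ^^ p) x = x)"

definition perfect_set :: "(nat \<Rightarrow> nat) set \<Rightarrow> bool" where
  "perfect_set \<Gamma> \<longleftrightarrow> closed \<Gamma> \<and> (\<forall>x\<in>\<Gamma>. \<not> x isolated_in \<Gamma>)"

definition segment :: "(nat \<Rightarrow> nat) \<Rightarrow> nat \<Rightarrow> nat \<Rightarrow> nat list" where
  "segment x i j = map x [i..<j]"

definition subword :: "nat list \<Rightarrow> nat \<Rightarrow> nat \<Rightarrow> nat list" where
  "subword w i j = map (\<lambda>k. w ! k) [i..<j]"

definition allowed_words :: "(nat \<Rightarrow> nat) set \<Rightarrow> nat list set" where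
  "allowed_words \<Gamma> = {w. \<exists>x\<in>\<Gamma>. \<exists>i. w = segment x i (i + length w)}"

definition forbidden_words :: "(nat \<Rightarrow> nat) set \<Rightarrow> nat list set" where
  "forbidden_words \<Gamma> = - allowed_words \<Gamma>"

definition forbidden_basis :: "(nat \<Rightarrow> nat) set \<Rightarrow> nat list set \<Rightarrow> bool" where
  "forbidden_basis \<Gamma> F \<longleftrightarrow> F \<subseteq> forbidden_words \<Gamma> \<and>
     (\<forall>w\<in>forbidden_words \<Gamma>. \<exists>i j. i < j \<and> j \<le> length w \<and> subword w i j \<in> F)"

definition bounded_type :: "(nat \<Rightarrow> nat) set \<Rightarrow> bool" where
  "bounded_type \<Gamma> \<longleftrightarrow> (\<exists>K\<ge>1. \<exists>F. forbidden_basis \<Gamma> F \<and> (\<forall>w\<in>F. length w < K))"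

definition xi :: "(nat \<Rightarrow> nat) \<Rightarrow> (nat \<Rightarrow> nat) \<Rightarrow> real \<Rightarrow> nat \<Rightarrow> nat" where
  "xi x y \<epsilon> n = card {i. i < n \<and> seq_dist ((shift_map ^^ i) x) ((shift_map ^^ i) y) < \<epsilon>}"

text \<open>Upper and lower limits are taken in \<^typ>\<open>ereal\<close>, since \<^const>\<open>limsup\<close> and \<^const>\<open>liminf\<close>
  require a complete lattice.\<close>

definition DC1_pair :: "(nat \<Rightarrow> nat) \<Rightarrow> (nat \<Rightarrow> nat) \<Rightarrow> bool" where
  "DC1_pair x y \<longleftrightarrow>
     (\<forall>\<epsilon>>0. limsup (\<lambda>n. ereal (real (xi x y \<epsilon> n) / real n)) = 1) \<and>
     (\<exists>\<delta>>0. liminf (\<lambda>n. ereal (real (xi x y \<delta> n) / real n)) = 0)"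

definition DC1_scrambled :: "(nat \<Rightarrow> nat) set \<Rightarrow> (nat \<Rightarrow> nat) set \<Rightarrow> bool" where
  "DC1_scrambled \<Gamma> D \<longleftrightarrow> D \<subseteq> \<Gamma> \<and> (\<forall>x\<in>D. \<forall>y\<in>D. x \<noteq> y \<longrightarrow> DC1_pair x y)"

end

theory Submission
  imports Defs
begin

text \<open>Let the forbidden words be generated by words shorter than \<open>K\<close>. Since \<open>\<Gamma>\<close> is perfect and has
  dense periodic points, it contains two periodic points \<open>p \<noteq> q\<close> with equal first \<open>K\<close> letters; let
  \<open>N \<ge> K\<close> be a common period. Every concatenation of the length-\<open>N\<close> prefixes of \<open>p\<close> and \<open>q\<close> lies in
  \<open>\<Gamma>\<close>, because each of its windows of length \<open>K\<close> occurs in \<open>p\<close> or in \<open>q\<close>. Along the blocks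
  \<open>[m!, (m+1)!)\<close>, which fill almost all of \<open>[0, (m+1)!)\<close>, repeat one of the two prefixes according
  to a bit \<open>a m\<close>. Two such points form a DC1 pair as soon as their bit sequences both agree and
  disagree infinitely often, and there are uncountably many such bit sequences.\<close>

section \<open>Cylinders in the product topology\<close>

lemma open_contains_cylinder:
  fixes S :: "(nat \<Rightarrow> 'a::topological_space) set"
  assumes "open S" "x \<in> S"
  shows "\<exists>n. \<forall>y. (\<forall>i<n. y i = x i) \<longrightarrow> y \<in> S"
proof -
  have "openin (product_topology (\<lambda>i. euclidean) UNIV) S"
    using assms(1) by (simp add: euclidean_product_topology)
  from product_topology_open_contains_basis[OF this assms(2)]
  obtain X where X: "x \<in> (\<Pi>\<^sub>E i\<in>UNIV. X i)" "finite {i. X i \<noteq> UNIV}" "(\<Pi>\<^sub>E i\<in>UNIV. X i) \<subseteq> S"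
    by auto
  obtain n where n: "\<And>i. X i \<noteq> UNIV \<Longrightarrow> i < n"
    using X(2) finite_nat_set_iff_bounded by auto
  have "y \<in> S" if "\<forall>i<n. y i = x i" for y
  proof -
    have "y i \<in> X i" for i
      using X(1) n[of i] that by (cases "i < n") (auto simp: PiE_iff)
    thus ?thesis using X(3) by (auto simp: PiE_iff)
  qed
  thus ?thesis by blast
qed

lemma open_cylinder:
  fixes x :: "nat \<Rightarrow> 'a::discrete_topology"
  shows "open {y. \<forall>i<n. y i = x i}"
proof -
  have "open (\<Pi>\<^sub>E i\<in>UNIV. if i < n then {x i} else UNIV)"
  proof (rule open_PiE)
    show "finite {i. (if i < n then {x i} else UNIV) \<noteq> UNIV}"
      by (rule finite_subset[of _ "{..<n}"]) auto
  qed (auto simp: open_discrete)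
  also have "(\<Pi>\<^sub>E i\<in>UNIV. if i < n then {x i} else UNIV) = {y. \<forall>i<n. y i = x i}"
    by (auto simp: PiE_iff split: if_splits)
  finally show ?thesis .
qed

section \<open>Membership in a subshift of bounded type\<close>

lemma shift_map_funpow: "(shift_map ^^ n) x = (\<lambda>i. x (i + n))"
  by (induction n) (auto simp: shift_map_def)

lemma subshift_funpow:
  assumes "subshift \<Gamma>" "x \<in> \<Gamma>"
  shows "(\<lambda>i. x (i + n)) \<in> \<Gamma>"
proof -
  have "(shift_map ^^ n) x \<in> \<Gamma>"
    using assms by (induction n) (auto simp: subshift_def)
  thus ?thesis by (simp add: shift_map_funpow)
qed

text \<open>If x lay outside the closed set, a whole cylinder around x would. The word defining that
  cylinder is read in some point of \<Gamma>, and shifting that point to the place of the occurrence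
  puts it into the cylinder.\<close>

lemma subshift_memI:
  assumes "subshift \<Gamma>" "\<And>n. segment x 0 n \<in> allowed_words \<Gamma>"
  shows "x \<in> \<Gamma>"
proof (rule ccontr)
  assume "x \<notin> \<Gamma>"
  moreover have "open (- \<Gamma>)" using assms(1) by (simp add: subshift_def open_Compl)
  ultimately obtain n where n: "\<And>y. (\<forall>i<n. y i = x i) \<Longrightarrow> y \<notin> \<Gamma>"
    using open_contains_cylinder[of "- \<Gamma>" x] by auto
  obtain y j where y: "y \<in> \<Gamma>" "segment x 0 n = segment y j (j + n)"
    using assms(2)[of n] by (auto simp: allowed_words_def segment_def)
  have "y (i + j) = x i" if "i < n" for i
    using arg_cong[OF y(2), of "\<lambda>w. w ! i"] that by (simp add: segment_def add.commute)
  with n[of "\<lambda>i. y (i + j)"] subshift_funpow[OF assms(1) y(1), of j] show False by simp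
qed

text \<open>A forbidden prefix of x would contain a basis word; being shorter than \<open>K\<close>,
  that word fits into a window of x, which is read in \<Gamma>.\<close>

lemma bounded_type_windows:
  assumes "subshift \<Gamma>" "bounded_type \<Gamma>"
  obtains K where "\<And>x. (\<And>i. \<exists>y\<in>\<Gamma>. \<exists>j. \<forall>t<K. x (i + t) = y (j + t)) \<Longrightarrow> x \<in> \<Gamma>"
proof -
  obtain K F where F: "forbidden_basis \<Gamma> F" "\<forall>w\<in>F. length w < K"
    using assms(2) unfolding bounded_type_def by blast
  have "x \<in> \<Gamma>" if x: "\<And>i. \<exists>y\<in>\<Gamma>. \<exists>j. \<forall>t<K. x (i + t) = y (j + t)" for x
  proof (rule subshift_memI[OF assms(1)], rule ccontr)
    fix n assume "segment x 0 n \<notin> allowed_words \<Gamma>"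
    then obtain i j where ij: "j \<le> length (segment x 0 n)" "subword (segment x 0 n) i j \<in> F"
      using F(1) unfolding forbidden_basis_def forbidden_words_def by blast
    hence "j \<le> n" by (simp add: segment_def)
    obtain y k where y: "y \<in> \<Gamma>" "\<forall>t<K. x (i + t) = y (k + t)"
      using x by blast
    have len: "j - i < K" using F(2) ij(2) by (auto simp: subword_def)
    have "subword (segment x 0 n) i j = segment y k (k + (j - i))"
      using \<open>j \<le> n\<close> len y(2) by (intro nth_equalityI) (auto simp: subword_def segment_def)
    hence "subword (segment x 0 n) i j \<in> allowed_words \<Gamma>"
      using y(1) by (auto simp: allowed_words_def segment_def)
    with F(1) ij(2) show False unfolding forbidden_basis_def forbidden_words_def by blast
  qed
  thus ?thesis using that by blast
qed

section \<open>Two periodic points with a common prefix\<close>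

lemma periodic_point_iff: "periodic_point x \<longleftrightarrow> (\<exists>P\<ge>1. \<forall>i. x (i + P) = x i)"
  by (simp add: periodic_point_def shift_map_funpow fun_eq_iff)

lemma periodic_mult:
  fixes x :: "nat \<Rightarrow> 'a" and k :: nat
  assumes "\<And>i. x (i + P) = x i"
  shows "x (i + k * P) = x i"
proof (induction k)
  case (Suc k)
  have "x (i + Suc k * P) = x ((i + k * P) + P)" by (simp add: ac_simps)
  with Suc assms show ?case by metis
qed simp

lemma periodic_pair:
  assumes "\<Gamma> \<noteq> {}" "\<Gamma> \<subseteq> closure {x \<in> \<Gamma>. periodic_point x}" "perfect_set \<Gamma>"
  obtains p q N where "p \<in> \<Gamma>" "q \<in> \<Gamma>" "p \<noteq> q" "\<forall>i<K. p i = q i" "N \<ge> 1" "N \<ge> K"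
    "\<And>i. p (i + N) = p i" "\<And>i. q (i + N) = q i"
proof -
  obtain p where p: "p \<in> \<Gamma>" "periodic_point p"
    using assms(1,2) by (cases "{x \<in> \<Gamma>. periodic_point x} = {}") auto
  define T where "T = {y. \<forall>i<K. y i = p i}"
  have T: "open T" "p \<in> T" using open_cylinder[of K p] by (auto simp: T_def)
  have "T \<inter> \<Gamma> \<noteq> {p}"
    using assms(3) p(1) T(1) by (auto simp: perfect_set_def isolated_in_def)
  then obtain y where y: "y \<in> T" "y \<noteq> p" "y \<in> \<Gamma>" using T(2) p(1) by auto
  then obtain j where j: "y j \<noteq> p j" by auto
  \<comment> \<open>Approximating y on this many letters preserves both the first \<open>K\<close>
    letters shared with p and the difference from p at position j.\<close>
  have "{x. \<forall>i<max K (Suc j). x i = y i} \<inter> closure {x \<in> \<Gamma>. periodic_point x} \<noteq> {}"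
    using y(3) assms(2) by auto
  hence "{x. \<forall>i<max K (Suc j). x i = y i} \<inter> {x \<in> \<Gamma>. periodic_point x} \<noteq> {}"
    unfolding open_Int_closure_eq_empty[OF open_cylinder] .
  then obtain q where q: "\<forall>i<max K (Suc j). q i = y i" "q \<in> \<Gamma>" "periodic_point q" by auto
  have q_prefix: "\<forall>i<K. p i = q i" using q(1) y(1) by (simp add: T_def)
  have "q j = y j" using q(1) by simp
  hence "p \<noteq> q" using j by auto
  obtain P Q where PQ: "P \<ge> 1" "Q \<ge> 1" "\<And>i. p (i + P) = p i" "\<And>i. q (i + Q) = q i"
    using p(2) q(3) by (auto simp: periodic_point_iff)
  \<comment> \<open>A common multiple of both periods; the factor \<open>Suc K\<close> gives
    \<open>N \<ge> K\<close> and keeps N positive even for \<open>K = 0\<close>.\<close>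
  define N where "N = Suc K * P * Q"
  have "p (i + N) = p i" for i
    using periodic_mult[of p P i "Suc K * Q", OF PQ(3)] by (simp only: N_def ac_simps)
  moreover have "q (i + N) = q i" for i
    using periodic_mult[of q Q i "Suc K * P", OF PQ(4)] by (simp only: N_def ac_simps)
  moreover have "N \<ge> Suc K * 1 * 1" unfolding N_def using PQ by (intro mult_mono) auto
  ultimately show thesis using p(1) q(2) q_prefix \<open>p \<noteq> q\<close> that[of p q N] by simp
qed

section \<open>Concatenations of two periodic blocks\<close>

definition interleave :: "nat \<Rightarrow> (nat \<Rightarrow> 'a) \<Rightarrow> (nat \<Rightarrow> 'a) \<Rightarrow> (nat \<Rightarrow> bool) \<Rightarrow> nat \<Rightarrow> 'a" where
  "interleave N p q s = (\<lambda>i. if s (i div N) then p i else q i)"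

text \<open>A window starting in block k follows one of p and q up to the end of that block. Any
  later position in it reduces modulo N to some \<open>r < K\<close>, where p and q agree, so the
  whole window is read in the point chosen for block k.\<close>

lemma interleave_mem:
  assumes windows: "\<And>x. (\<And>i. \<exists>y\<in>\<Gamma>. \<exists>j. \<forall>t<K. x (i + t) = y (j + t)) \<Longrightarrow> x \<in> \<Gamma>"
    and pq: "p \<in> \<Gamma>" "q \<in> \<Gamma>" "\<forall>i<K. p i = q i"
    and N: "N \<ge> 1" "N \<ge> K"
    and per: "\<And>i. p (i + N) = p i" "\<And>i. q (i + N) = q i"
  shows "interleave N p q s \<in> \<Gamma>"
proof (rule windows)
  fix i
  define k where "k = i div N"
  define y where "y = (if s k then p else q)"
  have "interleave N p q s (i + t) = y (i + t)" if t: "t < K" for t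
  proof (cases "i + t < Suc k * N")
    case True
    moreover have "k * N \<le> i + t" by (simp add: k_def trans_le_add1)
    ultimately have "(i + t) div N = k" by (intro div_nat_eqI) (simp_all add: mult.commute)
    thus ?thesis by (simp add: interleave_def y_def)
  next
    case False
    define r where "r = i + t - Suc k * N"
    have "i < N + k * N" using N(1) by (simp add: k_def dividend_less_div_times)
    hence r: "i + t = r + Suc k * N" "r < K"
      using False t unfolding r_def mult_Suc by linarith+
    have "p (i + t) = p r" "q (i + t) = q r"
      unfolding r(1) by (rule periodic_mult, rule per)+
    with pq(3) r(2) show ?thesis by (simp add: interleave_def y_def)
  qed
  moreover have "y \<in> \<Gamma>" using pq by (simp add: y_def)
  ultimately show "\<exists>y\<in>\<Gamma>. \<exists>j. \<forall>t<K. interleave N p q s (i + t) = y (j + t)" by blast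
qed

section \<open>Distances and the counting function\<close>

lemma seq_dist_le:
  assumes "\<forall>i<n. x i = y i"
  shows "seq_dist x y \<le> 1 / 2 ^ n"
  unfolding seq_dist_def
  by (rule cInf_lower) (use assms in \<open>auto intro!: bdd_belowI[of _ 0]\<close>)

text \<open>The strict bound forces agreement on some m > n letters, so index n itself is
  included.\<close>

lemma seq_dist_lessD:
  assumes "seq_dist x y < 1 / 2 ^ n" "i \<le> n"
  shows "x i = y i"
proof -
  have "{1 / 2 ^ n | n. \<forall>i<n. x i = y i} \<noteq> ({} :: real set)" by (auto intro: exI[of _ 0])
  from cInf_lessD[OF this] assms(1)
  obtain m where m: "\<forall>i<m. x i = y i" "1 / 2 ^ m < (1 / 2 ^ n :: real)"
    unfolding seq_dist_def by auto
  hence "(2::real) ^ n < 2 ^ m" by (simp add: field_simps)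
  hence "n < m" by simp
  thus ?thesis using m(1) assms(2) by auto
qed

lemma xi_le: "xi x y \<epsilon> n \<le> n"
  unfolding xi_def by (rule order.trans[OF card_mono[of "{..<n}"]]) auto

text \<open>Being closer than \<epsilon> at time i needs agreement on L letters from i on. Only the
  first A and the last L times can fail; the additive form avoids truncated subtraction.\<close>

lemma xi_agree:
  assumes agree: "\<And>i. A \<le> i \<Longrightarrow> i < n \<Longrightarrow> x i = y i" and "1 / 2 ^ L < \<epsilon>"
  shows "n \<le> xi x y \<epsilon> n + A + L"
proof -
  have "{A..<n - L} \<subseteq> {i. i < n \<and> seq_dist ((shift_map ^^ i) x) ((shift_map ^^ i) y) < \<epsilon>}"
  proof
    fix i assume i: "i \<in> {A..<n - L}"
    have "seq_dist ((shift_map ^^ i) x) ((shift_map ^^ i) y) \<le> 1 / 2 ^ L"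
      by (rule seq_dist_le) (use i in \<open>auto simp: shift_map_funpow intro!: agree\<close>)
    with assms(2) i
    show "i \<in> {i. i < n \<and> seq_dist ((shift_map ^^ i) x) ((shift_map ^^ i) y) < \<epsilon>}" by auto
  qed
  from card_mono[OF _ this] show ?thesis by (simp add: xi_def)
qed

text \<open>A disagreement within the L letters from i on keeps the distance at
  \<open>1 / 2 ^ L\<close> or more, so only times before A or among the last L can be
  counted.\<close>

lemma xi_differ:
  assumes differ: "\<And>i. A \<le> i \<Longrightarrow> i + L \<le> n \<Longrightarrow> \<exists>t<L. x (i + t) \<noteq> y (i + t)"
  shows "xi x y (1 / 2 ^ L) n \<le> A + L"
proof -
  have "{i. i < n \<and> seq_dist ((shift_map ^^ i) x) ((shift_map ^^ i) y) < 1 / 2 ^ L}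
      \<subseteq> {..<A} \<union> {n - L..<n}"
  proof
    fix i assume "i \<in> {i. i < n \<and> seq_dist ((shift_map ^^ i) x) ((shift_map ^^ i) y) < 1 / 2 ^ L}"
    hence i: "i < n" "\<And>t. t \<le> L \<Longrightarrow> x (i + t) = y (i + t)"
      using seq_dist_lessD by (fastforce simp: shift_map_funpow add.commute)+
    show "i \<in> {..<A} \<union> {n - L..<n}"
      using differ[of i] i by (cases "A \<le> i"; cases "i + L \<le> n") auto
  qed
  from card_mono[OF _ this] have "xi x y (1 / 2 ^ L) n \<le> card ({..<A} \<union> {n - L..<n})"
    by (simp add: xi_def)
  also have "\<dots> \<le> A + L" using card_Un_le[of "{..<A}" "{n - L..<n}"] by simp
  finally show ?thesis .
qed

section \<open>Criteria for upper and lower density\<close>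

lemma limsup_eq_1I:
  fixes f :: "nat \<Rightarrow> real"
  assumes "\<And>n. f n \<le> 1"
    and "\<exists>\<^sub>\<infinity>m. \<exists>n\<ge>m. f n \<ge> 1 - C / real (Suc m)"
  shows "limsup (\<lambda>n. ereal (f n)) = 1"
proof (rule antisym)
  show "limsup (\<lambda>n. ereal (f n)) \<le> 1"
    by (rule Limsup_bounded) (simp add: assms(1) one_ereal_def)
  show "1 \<le> limsup (\<lambda>n. ereal (f n))"
  proof (rule ccontr)
    assume "\<not> 1 \<le> limsup (\<lambda>n. ereal (f n))"
    \<comment> \<open>A real c strictly between the upper limit and 1: eventually f stays below c,
      while the error \<open>C / real (Suc m)\<close> drops below 1 - c.\<close>
    then obtain c where c: "limsup (\<lambda>n. ereal (f n)) < ereal c" "c < 1"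
      using ereal_dense2[of "limsup (\<lambda>n. ereal (f n))" 1]
      by (auto simp: not_le one_ereal_def)
    hence "\<forall>\<^sub>F n in sequentially. f n < c"
      using Limsup_lessD[OF c(1)] by simp
    then obtain M where M: "\<And>n. n \<ge> M \<Longrightarrow> f n < c"
      by (auto simp: eventually_sequentially)
    have "(\<lambda>m. C / real (Suc m)) \<longlonglongrightarrow> 0"
      by (rule LIMSEQ_Suc, rule lim_const_over_n)
    from order_tendstoD(2)[OF this, of "1 - c"] c(2)
    obtain M' where M': "\<And>m. m \<ge> M' \<Longrightarrow> C / real (Suc m) < 1 - c"
      by (auto simp: eventually_sequentially)
    obtain m n where "m > max M M'" "n \<ge> m" "f n \<ge> 1 - C / real (Suc m)"
      using assms(2) unfolding INFM_nat by blast
    with M[of n] M'[of m] show False by auto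
  qed
qed

lemma liminf_eq_0I:
  fixes f :: "nat \<Rightarrow> real"
  assumes "\<And>n. f n \<ge> 0"
    and "\<exists>\<^sub>\<infinity>m. \<exists>n\<ge>m. f n \<le> C / real (Suc m)"
  shows "liminf (\<lambda>n. ereal (f n)) = 0"
proof -
  \<comment> \<open>Complementing turns the lower limit into the upper one.\<close>
  have "limsup (\<lambda>n. ereal (1 - f n)) = 1"
    by (rule limsup_eq_1I[where C = C]) (use assms in auto)
  moreover have "liminf (\<lambda>n. 1 - ereal (1 - f n)) = 1 - limsup (\<lambda>n. ereal (1 - f n))"
    by (rule liminf_ereal_cminus) simp
  ultimately show ?thesis by (simp add: one_ereal_def zero_ereal_def)
qed

section \<open>Factorial blocks\<close>

text \<open>The value is \<open>a m\<close> throughout block m, and \<open>False\<close> at k = 0,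
  which lies in no block. Block 0 is empty, so \<open>a 0\<close> never appears.\<close>

definition block_seq :: "(nat \<Rightarrow> bool) \<Rightarrow> nat \<Rightarrow> bool" where
  "block_seq a k \<longleftrightarrow> (\<exists>m. fact m \<le> k \<and> k < fact (Suc m) \<and> a m)"

lemma block_seq_eq:
  assumes "fact m \<le> k" "k < fact (Suc m)"
  shows "block_seq a k = a m"
proof -
  have "m' = m" if "fact m' \<le> k" "k < fact (Suc m')" for m'
  proof (rule ccontr)
    assume "m' \<noteq> m"
    hence "Suc m' \<le> m \<or> Suc m \<le> m'" by linarith
    hence "(fact (Suc m') :: nat) \<le> fact m \<or> (fact (Suc m) :: nat) \<le> fact m'"
      using fact_mono_nat by blast
    with assms that show False by linarith
  qed
  with assms show ?thesis unfolding block_seq_def by blast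
qed

lemma interleave_block:
  assumes "N \<ge> 1" "N * fact m \<le> i" "i < N * fact (Suc m)"
  shows "interleave N p q (block_seq a) i = (if a m then p i else q i)"
proof -
  have "fact m \<le> i div N" "i div N < fact (Suc m)"
    using assms by (simp_all only: less_eq_div_iff_mult_less_eq div_less_iff_less_mult mult.commute)
  thus ?thesis by (simp add: interleave_def block_seq_eq)
qed

lemma block_end_ge:
  assumes "N \<ge> 1"
  shows "m \<le> N * fact (Suc m)"
proof -
  have "m \<le> fact (Suc m)" using fact_ge_self[of "Suc m"] by (rule Suc_leD)
  also have "\<dots> \<le> N * fact (Suc m)" using assms by (simp del: fact_Suc)
  finally show ?thesis .
qed

text \<open>Bounds the share of times up to the end of block m that the counting lemmas leave
  uncontrolled: those before the block and L at its end. As \<open>N * fact m\<close> is at least 1,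
  L is absorbed into a multiple of it.\<close>

lemma block_ratio_bound:
  assumes "N \<ge> 1"
  shows "real (N * fact m + L) / real (N * fact (Suc m)) \<le> (1 + real L) / real (Suc m)"
proof -
  have "real L \<le> real L * (real N * fact m)"
  proof -
    have "(1::nat) \<le> N * fact m" using assms by (simp add: Suc_le_eq)
    hence "real 1 \<le> real (N * fact m)" by (simp only: of_nat_le_iff)
    thus ?thesis using mult_left_mono[of 1 "real N * fact m" "real L"] by simp
  qed
  hence "real (N * fact m + L) \<le> (1 + real L) * (real N * fact m)"
    by (simp add: algebra_simps)
  moreover have eq: "real (N * fact (Suc m)) = real (Suc m) * (real N * fact m)"
    by (simp add: algebra_simps)
  ultimately have "real (N * fact m + L) / real (N * fact (Suc m))
      \<le> (1 + real L) * (real N * fact m) / (real (Suc m) * (real N * fact m))"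
    unfolding eq by (intro divide_right_mono) auto
  also have "\<dots> = (1 + real L) / real (Suc m)" using assms by simp
  finally show ?thesis .
qed

section \<open>Distributional chaos of interleaved points\<close>

lemma interleave_DC1:
  fixes p q :: "nat \<Rightarrow> nat"
  assumes N: "N \<ge> 1" and per: "\<And>i. p (i + N) = p i" "\<And>i. q (i + N) = q i" and "p \<noteq> q"
    and agree: "\<exists>\<^sub>\<infinity>m. a m = b m" and differ: "\<exists>\<^sub>\<infinity>m. a m \<noteq> b m"
  shows "DC1_pair (interleave N p q (block_seq a)) (interleave N p q (block_seq b))"
proof -
  let ?x = "interleave N p q (block_seq a)" and ?y = "interleave N p q (block_seq b)"
  have "limsup (\<lambda>n. ereal (real (xi ?x ?y \<epsilon> n) / real n)) = 1" if "\<epsilon> > 0" for \<epsilon>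
  proof -
    obtain L where L: "1 / 2 ^ L < \<epsilon>"
      using real_arch_pow_inv[OF \<open>\<epsilon> > 0\<close>, of "1/2"] by (auto simp: power_one_over)
    have *: "\<exists>n\<ge>m. real (xi ?x ?y \<epsilon> n) / real n \<ge> 1 - (1 + real L) / real (Suc m)"
      if "a m = b m" for m
    proof (intro exI conjI)
      \<comment> \<open>The end of block m; on this block both points follow the same one of p and
        q.\<close>
      let ?n = "N * fact (Suc m)"
      show "m \<le> ?n" by (rule block_end_ge[OF N])
      have "?n \<le> xi ?x ?y \<epsilon> ?n + N * fact m + L"
        by (rule xi_agree[OF _ L]) (simp only: interleave_block[OF N] that)
      hence "real ?n \<le> real (xi ?x ?y \<epsilon> ?n + (N * fact m + L))"
        unfolding add.assoc by (rule of_nat_mono)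
      moreover have "real ?n > 0" using N by (simp del: fact_Suc)
      ultimately have "1 \<le> real (xi ?x ?y \<epsilon> ?n + (N * fact m + L)) / real ?n"
        by (simp only: le_divide_eq_1_pos)
      hence "1 \<le> real (xi ?x ?y \<epsilon> ?n) / real ?n + real (N * fact m + L) / real ?n"
        by (simp only: of_nat_add add_divide_distrib add.assoc)
      thus "real (xi ?x ?y \<epsilon> ?n) / real ?n \<ge> 1 - (1 + real L) / real (Suc m)"
        using block_ratio_bound[OF N, of m L] by linarith
    qed
    show ?thesis
    proof (rule limsup_eq_1I)
      show "real (xi ?x ?y \<epsilon> n) / real n \<le> 1" for n
        using xi_le[of ?x ?y \<epsilon> n] by (simp add: divide_le_eq)
      show "\<exists>\<^sub>\<infinity>m. \<exists>n\<ge>m. real (xi ?x ?y \<epsilon> n) / real n \<ge> 1 - (1 + real L) / real (Suc m)"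
        using agree by (rule INFM_mono) (rule *)
    qed
  qed
  moreover have "liminf (\<lambda>n. ereal (real (xi ?x ?y (1 / 2 ^ N) n) / real n)) = 0"
  proof -
    obtain j where j: "p j \<noteq> q j" using \<open>p \<noteq> q\<close> by auto
    have window: "\<exists>t<N. p (i + t) \<noteq> q (i + t)" for i
    proof (intro exI conjI)
      \<comment> \<open>Chosen so that i + t is congruent to j modulo N; adding \<open>i * N\<close>
        makes the natural subtraction exact.\<close>
      let ?t = "(j + i * N - i) mod N"
      show "?t < N" using N by simp
      have "i \<le> j + i * N" using mult_le_mono2[OF N, of i] by linarith
      hence eq: "i + ?t + (j + i * N - i) div N * N = j + i * N"
        using mod_div_mult_eq[of "j + i * N - i" N] by linarith
      have *: "f (i + ?t) = f j" if f: "\<And>i. f (i + N) = f i" for f :: "nat \<Rightarrow> nat"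
      proof -
        have "f (i + ?t) = f (i + ?t + (j + i * N - i) div N * N)"
          by (rule periodic_mult[symmetric], rule f)
        also have "\<dots> = f j" unfolding eq by (rule periodic_mult, rule f)
        finally show ?thesis .
      qed
      from *[of p, OF per(1)] *[of q, OF per(2)] j show "p (i + ?t) \<noteq> q (i + ?t)" by simp
    qed
    have *: "\<exists>n\<ge>m. real (xi ?x ?y (1 / 2 ^ N) n) / real n \<le> (1 + real N) / real (Suc m)"
      if "a m \<noteq> b m" for m
    proof (intro exI conjI)
      let ?n = "N * fact (Suc m)"
      show "m \<le> ?n" by (rule block_end_ge[OF N])
      have "xi ?x ?y (1 / 2 ^ N) ?n \<le> N * fact m + N"
      proof (rule xi_differ)
        fix i assume i: "N * fact m \<le> i" "i + N \<le> ?n"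
        obtain t where t: "t < N" "p (i + t) \<noteq> q (i + t)" using window by blast
        have "N * fact m \<le> i + t" "i + t < ?n" using i t(1) by linarith+
        \<comment> \<open>On block m one point follows p and the other q, so a difference of p and q
          separates them.\<close>
        hence "?x (i + t) \<noteq> ?y (i + t)"
          using t(2) that by (auto simp only: interleave_block[OF N] split: if_splits)
        thus "\<exists>t<N. ?x (i + t) \<noteq> ?y (i + t)" using t(1) by blast
      qed
      hence "real (xi ?x ?y (1 / 2 ^ N) ?n) / real ?n \<le> real (N * fact m + N) / real ?n"
        by (intro divide_right_mono) (simp_all only: of_nat_le_iff of_nat_0_le_iff)
      thus "real (xi ?x ?y (1 / 2 ^ N) ?n) / real ?n \<le> (1 + real N) / real (Suc m)"
        using block_ratio_bound[OF N, of m N] by linarith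
    qed
    show ?thesis
    proof (rule liminf_eq_0I)
      show "\<exists>\<^sub>\<infinity>m. \<exists>n\<ge>m. real (xi ?x ?y (1 / 2 ^ N) n) / real n \<le> (1 + real N) / real (Suc m)"
        using differ by (rule INFM_mono) (rule *)
    qed simp
  qed
  moreover have "(1 / 2 ^ N :: real) > 0" by simp
  ultimately show ?thesis unfolding DC1_pair_def by blast
qed

text \<open>Even positions agree for all \<open>\<alpha>\<close>, while the odd positions repeat each bit of \<open>\<alpha>\<close> infinitely
  often.\<close>

definition spread :: "(nat \<Rightarrow> bool) \<Rightarrow> nat \<Rightarrow> bool" where
  "spread \<alpha> m \<longleftrightarrow> odd m \<and> \<alpha> (fst (prod_decode (m div 2)))"

lemma spread_agree: "\<exists>\<^sub>\<infinity>m. spread \<alpha> m = spread \<beta> m"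
  unfolding INFM_nat_le
proof
  fix m
  show "\<exists>n\<ge>m. spread \<alpha> n = spread \<beta> n"
    by (rule exI[of _ "2 * m"]) (simp add: spread_def)
qed

lemma spread_differ:
  assumes "\<alpha> \<noteq> \<beta>"
  shows "\<exists>\<^sub>\<infinity>m. spread \<alpha> m \<noteq> spread \<beta> m"
  unfolding INFM_nat_le
proof
  fix m
  obtain j where j: "\<alpha> j \<noteq> \<beta> j" using assms by auto
  have "m \<le> prod_encode (j, m)" by (rule le_prod_encode_2)
  with j show "\<exists>n\<ge>m. spread \<alpha> n \<noteq> spread \<beta> n"
    \<comment> \<open>Halving and decoding this odd position returns j; varying m gives arbitrarily
      large such positions.\<close>
    by (intro exI[of _ "2 * prod_encode (j, m) + 1"]) (simp add: spread_def)
qed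

text \<open>Every time is counted for a point paired with itself, so the lower density is 1. This
  yields injectivity of the parametrization by bit sequences.\<close>

lemma DC1_pair_irrefl: "\<not> DC1_pair x x"
proof
  assume "DC1_pair x x"
  then obtain \<delta> where \<delta>: "\<delta> > 0" "liminf (\<lambda>n. ereal (real (xi x x \<delta> n) / real n)) = 0"
    by (auto simp: DC1_pair_def)
  obtain L where "1 / 2 ^ L < \<delta>"
    using real_arch_pow_inv[OF \<delta>(1), of "1/2"] by (auto simp: power_one_over)
  hence "seq_dist z z < \<delta>" for z
    using seq_dist_le[of L z z] by auto
  hence "xi x x \<delta> n = n" for n by (simp add: xi_def)
  \<comment> \<open>Eventually suffices: at n = 0 the quotient is 0 by division by zero.\<close>
  hence "\<forall>\<^sub>F n in sequentially. 1 \<le> ereal (real (xi x x \<delta> n) / real n)"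
    by (auto simp: eventually_sequentially one_ereal_def intro!: exI[of _ 1])
  from Liminf_bounded[OF this] \<delta>(2) show False by simp
qed

text \<open>Cantor's diagonal argument.\<close>

lemma uncountable_bool_seqs: "uncountable (UNIV :: (nat \<Rightarrow> bool) set)"
proof
  assume "countable (UNIV :: (nat \<Rightarrow> bool) set)"
  then obtain f :: "nat \<Rightarrow> nat \<Rightarrow> bool" where "range f = UNIV"
    by (metis UNIV_not_empty uncountable_def)
  then obtain n where "f n = (\<lambda>k. \<not> f k k)" by (metis UNIV_I imageE)
  thus False by (metis (full_types))
qed

theorem theorem16:
  fixes \<Gamma> :: "(nat \<Rightarrow> nat) set"
  assumes "\<Gamma> \<noteq> {}"
    and "subshift \<Gamma>"
    and "bounded_type \<Gamma>"
    and "\<Gamma> \<subseteq> closure {x \<in> \<Gamma>. periodic_point x}"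
    and "perfect_set \<Gamma>"
  shows "\<exists>D. uncountable D \<and> DC1_scrambled \<Gamma> D"
proof -
  obtain K where K: "\<And>x. (\<And>i. \<exists>y\<in>\<Gamma>. \<exists>j. \<forall>t<K. x (i + t) = y (j + t)) \<Longrightarrow> x \<in> \<Gamma>"
    using bounded_type_windows[OF assms(2,3)] by blast
  obtain p q N where pq: "p \<in> \<Gamma>" "q \<in> \<Gamma>" "p \<noteq> q" "\<forall>i<K. p i = q i"
    and N: "N \<ge> 1" "N \<ge> K" and per: "\<And>i. p (i + N) = p i" "\<And>i. q (i + N) = q i"
    using periodic_pair[OF assms(1,4,5)] by metis
  define z where "z \<alpha> = interleave N p q (block_seq (spread \<alpha>))" for \<alpha>
  have DC1: "DC1_pair (z \<alpha>) (z \<beta>)" if "\<alpha> \<noteq> \<beta>" for \<alpha> \<beta>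
    unfolding z_def using N(1) per pq(3) spread_agree spread_differ[OF that]
    by (rule interleave_DC1)
  \<comment> \<open>If two distinct bit sequences gave one point, that point would form a DC1 pair
    with itself.\<close>
  hence "inj z" using DC1_pair_irrefl by (metis injI)
  hence "uncountable (range z)"
    using uncountable_bool_seqs countable_image_inj_on by blast
  moreover have "z \<alpha> \<in> \<Gamma>" for \<alpha>
    unfolding z_def using K pq(1,2,4) N per by (rule interleave_mem)
  hence "DC1_scrambled \<Gamma> (range z)"
    unfolding DC1_scrambled_def by (auto intro!: DC1)
  ultimately show ?thesis by blast
qed

end
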